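(* Let $G=(V,E)$ be a graph with diameter $2$ and an even number $n\ge 90$ of vertices. For each integer $i\ge 0$ let $V_i=\{v\in V:\deg(v)=i\}$. If $G$ satisfies one of the following conditions: (1) $|\{i: |V_i| \text{ is odd}\}|>n/2$, or (2) $|V_i|$ is even for every $i$, then $h(G)=n/2$.
   Context: For a graph $G$ and $S\subseteq V(G)$, the distance multiset $D(S)$ is the multiset of shortest-path distances in $G$ between all unordered pairs of distinct vertices of $S$. Two vertex sets $S_1,S_2$ are homometric if $D(S_1)=D(S_2)$. $h(G)$ is the largest integer $h$ such that $G$ contains two disjoint homometric sets $S_1,S_2$ with $|S_1|=|S_2|=h$. *)

theory Defs
  imports "Graph_Theory.Shortest_Path" "HOL-Library.Multiset"
begin

text \<open>
  A finite simple graph is an instance of the locale \<^locale>\<open>graph\<close>: every undirected edge is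
  represented by its two opposite arcs, so the degree of a vertex is its out-degree.
\<close>

context graph
begin

text \<open>
  With unit weights, the weighted shortest-path distance is the least number of edges on a walk
  between two vertices; it is infinite if there is no such walk.
\<close>

definition gdist :: "'a \<Rightarrow> 'a \<Rightarrow> ereal" where
  "gdist u v = \<mu> (\<lambda>_. 1) u v"

definition diameter :: ereal where
  "diameter = (SUP u\<in>verts G. SUP v\<in>verts G. gdist u v)"

definition degree_class :: "nat \<Rightarrow> 'a set" where
  "degree_class i = {v \<in> verts G. out_degree G v = i}"

text \<open>
  Well-defined because the distance is symmetric; see \<open>pair_dist_eq\<close> below.
\<close>

definition pair_dist :: "'a set \<Rightarrow> ereal" where
  "pair_dist e = (THE d. \<exists>u v. e = {u, v} \<and> d = gdist u v)"

text \<open>Only meant for finite \<open>S\<close>: \<^const>\<open>mset_set\<close> is empty on infinite sets.\<close>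

definition distance_mset :: "'a set \<Rightarrow> ereal multiset" where
  "distance_mset S = image_mset pair_dist (mset_set {e. e \<subseteq> S \<and> card e = 2})"

definition homometric :: "'a set \<Rightarrow> 'a set \<Rightarrow> bool" where
  "homometric S T \<longleftrightarrow> distance_mset S = distance_mset T"

definition homometric_sizes :: "nat set" where
  "homometric_sizes = {h. \<exists>S T. S \<subseteq> verts G \<and> T \<subseteq> verts G \<and> S \<inter> T = {} \<and>
     homometric S T \<and> card S = h \<and> card T = h}"

text \<open>The maximum exists; see \<open>finite_homometric_sizes\<close> and \<open>zero_in_homometric_sizes\<close> below.\<close>

definition homometric_number :: nat where
  "homometric_number = Max homometric_sizes"

lemma awalk_cost_unit: "awalk_cost (\<lambda>_. 1) p = real (length p)"
  by (induction p) auto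

lemma awalk_reverse:
  assumes "awalk u p v"
  shows "\<exists>q. awalk v q u \<and> length q = length p"
  using assms
proof (induction p arbitrary: u)
  case Nil
  then show ?case by (auto simp: awalk_Nil_iff intro!: exI[of _ "[]"])
next
  case (Cons e p)
  then have e: "e \<in> arcs G" "u = tail G e" and p: "awalk (head G e) p v"
    by (auto simp: awalk_Cons_iff)
  obtain q where q: "awalk v q (head G e)" "length q = length p"
    using Cons.IH[OF p] by blast
  obtain e' where e': "e' \<in> arcs G" "tail G e' = head G e" "head G e' = tail G e"
    using sym_arcs e(1) by (fastforce simp: symmetric_conv)
  have "awalk (head G e) [e'] u"
    using e e' by (simp add: awalk_Cons_iff awalk_Nil_iff)
  with q(1) have "awalk v (q @ [e']) u" by (rule awalk_appendI)
  with q(2) show ?case by (intro exI[of _ "q @ [e']"]) simp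
qed

lemma gdist_le_reverse: "gdist u v \<le> gdist v u"
  unfolding gdist_def \<mu>_def
proof (rule INF_mono)
  fix p assume "p \<in> {p. awalk v p u}"
  then obtain q where "awalk u q v" "length q = length p"
    using awalk_reverse by blast
  then show "\<exists>q\<in>{p. awalk u p v}. ereal (awalk_cost (\<lambda>_. 1) q) \<le> ereal (awalk_cost (\<lambda>_. 1) p)"
    by (auto simp: awalk_cost_unit)
qed

lemma gdist_commute: "gdist u v = gdist v u"
  by (intro antisym gdist_le_reverse)

lemma pair_dist_eq: "pair_dist {u, v} = gdist u v"
  unfolding pair_dist_def by (rule the_equality) (auto simp: doubleton_eq_iff gdist_commute)

lemma finite_homometric_sizes: "finite homometric_sizes"
proof (rule finite_subset)
  show "homometric_sizes \<subseteq> {..card (verts G)}"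
    by (auto simp: homometric_sizes_def intro: card_mono)
qed simp

lemma zero_in_homometric_sizes: "0 \<in> homometric_sizes"
  by (auto simp: homometric_sizes_def homometric_def intro!: exI[of _ "{}"])

end

end

theory Submission
  imports Defs
begin

text \<open>
  In a graph of diameter 2 the distance multiset of \<open>S\<close> is determined by \<open>card S\<close> and the number
  \<open>e S\<close> of edges inside \<open>S\<close>, and for a partition \<open>V = S \<union> T\<close> the difference of the degree sums is
  \<open>2 * (e S - e T)\<close>. So it suffices to split the degree multiset into two parts of equal size and
  equal sum. Equal degrees can be paired off, which leaves either nothing or an even number
  \<open>2 * m > n / 2\<close> of distinct degrees \<open>x 0 < \<dots> < x (2 * m - 1)\<close> in \<open>{1..n - 1}\<close>, hence with span at most \<open>4 * m - 4\<close>.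

  Pair these numbers up and send the two members of each pair to different sides. If the \<open>i\<close>-th
  narrowest of the pairs has width at most \<open>i\<close>, then treating the pairs from the widest to the
  narrowest and always decreasing the absolute value of the current difference ends within 1 of 0,
  and hence at 0 by parity. Pairing \<open>x (2 * i)\<close> with \<open>x (2 * i + 1)\<close> satisfies this
  unless every pair has width at least 2, or a single pair is wider than \<open>m\<close>. In the first case some four
  consecutive numbers are paired as inner and outer pair instead. In the second case all other gaps
  are small, and one or two long pairs next to the wide gap, with narrow pairs nested inside them,
  compensate for its width.
\<close>

section \<open>Balancing pairs\<close>

definition splits :: "int multiset \<Rightarrow> int \<Rightarrow> bool" where
  "splits X s \<longleftrightarrow> (\<exists>A B. X = A + B \<and> size A = size B \<and> \<Sum>\<^sub># A - \<Sum>\<^sub># B = s)"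

text \<open>The bound is 1 rather than 0 because the parity is known only for the whole multiset,
  not for the part \<open>X\<close> that is used last.\<close>

definition steers :: "int multiset \<Rightarrow> int \<Rightarrow> bool" where
  "steers X k \<longleftrightarrow> (\<forall>s. \<bar>s\<bar> \<le> k \<longrightarrow> (\<exists>t. splits X t \<and> \<bar>s + t\<bar> \<le> 1))"

lemma splits_empty: "splits {#} 0"
  by (auto simp: splits_def)

lemma splits_pair: "splits {#a, b#} (a - b)"
  unfolding splits_def by (intro exI[of _ "{#a#}"] exI[of _ "{#b#}"]) auto

lemma splits_add:
  assumes "splits X s" "splits Y t" shows "splits (X + Y) (s + t)"
proof -
  from assms obtain A B C D where "X = A + B" "size A = size B" "\<Sum>\<^sub># A - \<Sum>\<^sub># B = s"
    "Y = C + D" "size C = size D" "\<Sum>\<^sub># C - \<Sum>\<^sub># D = t"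
    unfolding splits_def by blast
  then show ?thesis
    unfolding splits_def by (intro exI[of _ "A + C"] exI[of _ "B + D"]) auto
qed

lemma splits_double: "splits (X + X) 0"
  by (auto simp: splits_def)

lemma splits_parity:
  assumes "splits X s" shows "even s \<longleftrightarrow> even (\<Sum>\<^sub># X)"
  using assms by (auto simp: splits_def)

lemma steers_empty: "steers {#} 1"
  unfolding steers_def using splits_empty by fastforce

text \<open>Orient the pair against the sign of \<open>s\<close>: width at least 1 brings
  \<open>k + 1\<close> down to \<open>k\<close>, and width at most \<open>k\<close> keeps a small
  difference from overshooting \<open>k\<close> on the other side.\<close>

lemma steers_add_pair:
  assumes "steers X k" "a < b" "b - a \<le> k"
  shows "steers (X + {#a, b#}) (k + 1)"
  unfolding steers_def
proof (intro allI impI)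
  fix s :: int assume s: "\<bar>s\<bar> \<le> k + 1"
  define d where "d = (if 0 \<le> s then a - b else b - a)"
  have d: "splits {#a, b#} d"
    using splits_pair[of a b] splits_pair[of b a] by (auto simp: d_def add_mset_commute)
  have "\<bar>s + d\<bar> \<le> k" using s assms by (auto simp: d_def)
  then obtain t where "splits X t" "\<bar>s + d + t\<bar> \<le> 1"
    using assms(1) unfolding steers_def by blast
  with d show "\<exists>t. splits (X + {#a, b#}) t \<and> \<bar>s + t\<bar> \<le> 1"
    by (intro exI[of _ "t + d"] conjI splits_add) (auto simp: algebra_simps)
qed

text \<open>Every split difference has the parity of the total sum, so an even total turns a final
  difference within 1 into 0.\<close>

lemma steers_splits_zero:
  assumes "steers X k" "splits Y s" "\<bar>s\<bar> \<le> k" "even (\<Sum>\<^sub># (X + Y))"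
  shows "splits (X + Y) 0"
proof -
  obtain t where t: "splits X t" "\<bar>s + t\<bar> \<le> 1"
    using assms unfolding steers_def by blast
  have *: "splits (X + Y) (t + s)" using t assms by (intro splits_add)
  then have "even (t + s)" using splits_parity assms(4) by blast
  with t(2) have "t + s = 0" by presburger
  with * show ?thesis by simp
qed

section \<open>Families of pairs and width conditions under which they balance\<close>

definition flat :: "(int \<times> int) multiset \<Rightarrow> int multiset" where
  "flat P = (\<Sum>p\<in>#P. {#fst p, snd p#})"

definition width :: "int \<times> int \<Rightarrow> int" where
  "width p = snd p - fst p"

text \<open>The total width beyond the least possible one; it can be bounded through the span of the
  numbers.\<close>

definition excess :: "(int \<times> int) multiset \<Rightarrow> int" where
  "excess P = (\<Sum>p\<in>#P. width p - 1)"

lemma flat_simps [simp]: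
  "flat {#} = {#}" "flat (P + Q) = flat P + flat Q"
  "flat (add_mset p P) = flat P + {#fst p, snd p#}"
  by (auto simp: flat_def)

lemma excess_simps [simp]:
  "excess {#} = 0" "excess (P + Q) = excess P + excess Q"
  "excess (add_mset p P) = excess P + width p - 1"
  by (auto simp: excess_def)

text \<open>The second assumption says that the \<open>i\<close>-th narrowest pair has width at most
  \<open>i\<close>. The widest pair is used first, and the induction removes it.\<close>

lemma steers_flat:
  assumes "\<And>p. p \<in># P \<Longrightarrow> 1 \<le> width p"
    and "\<And>v. v \<le> size P \<Longrightarrow> v \<le> size {#p \<in># P. width p \<le> int v#}"
  shows "steers (flat P) (int (size P) + 1)"
  using assms
proof (induction "size P" arbitrary: P)
  case 0
  then show ?case using steers_empty by simp
next
  case (Suc r)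
  then have "P \<noteq> {#}" by auto
  have "finite (width ` set_mset P)" "width ` set_mset P \<noteq> {}"
    using \<open>P \<noteq> {#}\<close> by auto
  then obtain p where p: "p \<in># P" and max: "\<And>q. q \<in># P \<Longrightarrow> width q \<le> width p"
    using Max_in[of "width ` set_mset P"] Max_ge[of "width ` set_mset P"] by (metis imageE imageI)
  obtain Q where P: "P = add_mset p Q" using p by (metis mset_add)
  have r: "size Q = r" using Suc.hyps P by simp
  \<comment> \<open>The assumption at \<open>v = size P\<close> forces every width to be at most
    \<open>size P\<close>.\<close>
  have "size {#q \<in># P. width q \<le> int (size P)#} = size P"
    using Suc.prems(2)[of "size P"] size_filter_mset_lesseq le_antisym by blast
  then have "{#q \<in># P. width q \<le> int (size P)#} = P"
    by (metis multiset_filter_subset nless_le mset_subset_size subset_mset.less_le)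
  then have wp: "width p \<le> int (size P)" using p by (metis filter_mset_eq_conv)
  have "steers (flat Q) (int (size Q) + 1)"
  proof (rule Suc.hyps(1))
    show "r = size Q" using r by simp
    show "1 \<le> width q" if "q \<in># Q" for q using that Suc.prems(1) P by simp
    fix v assume v: "v \<le> size Q"
    \<comment> \<open>If \<open>p\<close> is narrow enough to count at \<open>v\<close>, so is all
      of \<open>Q\<close>; otherwise removing \<open>p\<close> does not change the count.\<close>
    show "v \<le> size {#q \<in># Q. width q \<le> int v#}"
    proof (cases "width p \<le> int v")
      case True
      then have "{#q \<in># Q. width q \<le> int v#} = Q"
        using max P by (force simp: filter_mset_eq_conv)
      then show ?thesis using v by simp
    next
      case False
      then show ?thesis using Suc.prems(2)[of v] v P by simp
    qed
  qed
  then have "steers (flat Q + {#fst p, snd p#}) (int (size Q) + 1 + 1)"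
    using wp Suc.prems(1)[OF p] P by (intro steers_add_pair) (auto simp: width_def)
  then show ?case using P by (simp add: add.commute)
qed

lemma excess_ge_count_wide:
  assumes "\<And>p. p \<in># P \<Longrightarrow> 1 \<le> width p"
  shows "int v * int (size {#p \<in># P. \<not> width p \<le> int v#}) \<le> excess P"
  using assms
proof (induction P)
  case (add p P)
  then have "int v * int (size {#p \<in># P. \<not> width p \<le> int v#}) \<le> excess P" "1 \<le> width p"
    by auto
  then show ?case by (auto simp: algebra_simps)
qed auto

text \<open>If the count fails at \<open>v\<close>, at least \<open>size P + 1 - v\<close> pairs are
  wider than \<open>v\<close>, and each of them contributes at least \<open>v\<close> to the
  excess.\<close>

lemma steers_flat_if_excess:
  assumes "\<And>p. p \<in># P \<Longrightarrow> 1 \<le> width p"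
    and "\<And>v. 1 \<le> v \<Longrightarrow> v \<le> size P \<Longrightarrow> size {#p \<in># P. width p \<le> int v#} < v
          \<Longrightarrow> excess P < int v * (int (size P) + 1 - int v)"
  shows "steers (flat P) (int (size P) + 1)"
proof (rule steers_flat)
  fix v assume v: "v \<le> size P"
  show "v \<le> size {#p \<in># P. width p \<le> int v#}"
  proof (rule ccontr)
    assume "\<not> ?thesis"
    then have less: "size {#p \<in># P. width p \<le> int v#} < v" by simp
    have "size {#p \<in># P. width p \<le> int v#} + size {#p \<in># P. \<not> width p \<le> int v#} = size P"
      by (metis multiset_partition size_union)
    then have "int (size P) + 1 - int v \<le> int (size {#p \<in># P. \<not> width p \<le> int v#})"
      using less by linarith
    then have "int v * (int (size P) + 1 - int v) \<le> excess P"
      using excess_ge_count_wide[OF assms(1), of P v]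
      by (meson mult_left_mono of_nat_0_le_iff order_trans)
    with assms(2)[of v] less v show False by fastforce
  qed
qed (use assms(1) in auto)

text \<open>The bound \<open>v * (r + 1 - v)\<close> with \<open>r = size P\<close> is concave in
  \<open>v\<close>, so on \<open>1..r\<close> it is least at the ends, where it equals
  \<open>r\<close>.\<close>

lemma steers_flat_if_excess_small:
  assumes "\<And>p. p \<in># P \<Longrightarrow> 1 \<le> width p" and "excess P < int (size P)"
  shows "steers (flat P) (int (size P) + 1)"
proof (rule steers_flat_if_excess)
  fix v assume v: "1 \<le> v" "v \<le> size P"
  have "0 \<le> (int v - 1) * (int (size P) - int v)" using v by simp
  then show "excess P < int v * (int (size P) + 1 - int v)"
    using assms(2) by (simp add: algebra_simps)
qed (use assms in auto)

text \<open>The pair of width 1 excludes failure at \<open>v = 1\<close>, the width bound excludes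
  it at \<open>v = size P\<close>. On the range in between the concave bound is at least
  \<open>2 * size P - 2\<close>.\<close>

lemma steers_flat_if_one_narrow:
  assumes "\<And>p. p \<in># P \<Longrightarrow> 1 \<le> width p" and "excess P < 2 * int (size P) - 2"
    and "\<And>p. p \<in># P \<Longrightarrow> width p \<le> int (size P)" and "q \<in># P" "width q = 1"
  shows "steers (flat P) (int (size P) + 1)"
proof (rule steers_flat_if_excess)
  fix v assume v: "1 \<le> v" "v \<le> size P"
    and less: "size {#p \<in># P. width p \<le> int v#} < v"
  have "v \<noteq> size P"
  proof
    assume "v = size P"
    then have "{#p \<in># P. width p \<le> int v#} = P" using assms(3) by (simp add: filter_mset_eq_conv)
    with less \<open>v = size P\<close> show False by simp
  qed
  moreover have "v \<noteq> 1"
  proof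
    assume "v = 1"
    then have "{#p \<in># P. width p \<le> int v#} = {#}" using less by simp
    then show False using assms(4,5) \<open>v = 1\<close> by (auto simp: filter_mset_eq_conv)
  qed
  ultimately have "0 \<le> (int v - 2) * (int (size P) - 1 - int v)" using v by simp
  then show "excess P < int v * (int (size P) + 1 - int v)"
    using assms(2) by (simp add: algebra_simps)
qed (use assms in auto)

section \<open>Increasing sequences of small span\<close>

locale spread_sequence =
  fixes x :: "nat \<Rightarrow> int" and m :: nat
  assumes strict: "\<And>i j. i < j \<Longrightarrow> j < 2 * m \<Longrightarrow> x i < x j"
    and span: "x (2 * m - 1) - x 0 \<le> 4 * int m - 4"
    and large: "8 \<le> m"
begin

text \<open>
  \<open>u\<close> and \<open>v\<close> are the gaps reduced by 1: \<open>u\<close> inside the pairs \<open>x (2 * i), x (2 * i + 1)\<close>, \<open>v\<close> between them.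
\<close>

definition u :: "nat \<Rightarrow> int" where "u i = x (2 * i + 1) - x (2 * i) - 1"
definition v :: "nat \<Rightarrow> int" where "v i = x (2 * i + 2) - x (2 * i + 1) - 1"

definition u_pairs :: "nat set \<Rightarrow> (int \<times> int) multiset" where
  "u_pairs A = image_mset (\<lambda>i. (x (2 * i), x (2 * i + 1))) (mset_set A)"

definition v_pairs :: "nat set \<Rightarrow> (int \<times> int) multiset" where
  "v_pairs A = image_mset (\<lambda>i. (x (2 * i + 1), x (2 * i + 2))) (mset_set A)"

lemma u_nonneg: "i < m \<Longrightarrow> 0 \<le> u i"
  using strict[of "2 * i" "2 * i + 1"] by (simp add: u_def)

lemma v_nonneg: "i < m - 1 \<Longrightarrow> 0 \<le> v i"
  using strict[of "2 * i + 1" "2 * i + 2"] by (simp add: v_def)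

lemma size_pairs [simp]: "size (u_pairs A) = card A" "size (v_pairs A) = card A"
  by (simp_all add: u_pairs_def v_pairs_def)

lemma excess_pairs [simp]: "excess (u_pairs A) = sum u A" "excess (v_pairs A) = sum v A"
  by (simp_all add: excess_def u_pairs_def v_pairs_def width_def u_def v_def
      image_mset.compositionality o_def sum_unfold_sum_mset)

lemma width_u_pairs: "finite A \<Longrightarrow> p \<in># u_pairs A \<Longrightarrow> \<exists>i\<in>A. width p = u i + 1"
  by (auto simp: u_pairs_def width_def u_def)

lemma width_v_pairs: "finite A \<Longrightarrow> p \<in># v_pairs A \<Longrightarrow> \<exists>i\<in>A. width p = v i + 1"
  by (auto simp: v_pairs_def width_def v_def)

lemma u_pairs_Un:
  "finite A \<Longrightarrow> finite B \<Longrightarrow> A \<inter> B = {} \<Longrightarrow> u_pairs (A \<union> B) = u_pairs A + u_pairs B"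
  by (simp add: u_pairs_def mset_set_Union)

lemma u_pairs_concat:
  "a \<le> b \<Longrightarrow> b \<le> c \<Longrightarrow> u_pairs {a..<c} = u_pairs {a..<b} + u_pairs {b..<c}"
  using u_pairs_Un[of "{a..<b}" "{b..<c}"] by (simp add: ivl_disj_un ivl_disj_int)

lemma flat_u_pairs: "flat (u_pairs {..<k}) = image_mset x (mset_set {..<2 * k})"
  by (induction k) (auto simp: u_pairs_def lessThan_Suc)

text \<open>Re-pairing a block: its two extreme entries form one long pair, and the entries inside
  are paired across the \<open>v\<close> gaps.\<close>

lemma flat_u_pairs_nested:
  assumes "l < e"
  shows "flat (u_pairs {l..<e}) = flat (v_pairs {l..<e - 1}) + {#x (2 * l), x (2 * e - 1)#}"
proof -
  have "flat (u_pairs {l..<Suc k}) = flat (v_pairs {l..<k}) + {#x (2 * l), x (2 * k + 1)#}"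
    if "l \<le> k" for k
    using that
  proof (induction k rule: dec_induct)
    case base
    then show ?case by (simp add: u_pairs_def v_pairs_def)
  next
    case (step k)
    have "{l..<Suc k} = insert k {l..<k}" "{l..<Suc (Suc k)} = insert (Suc k) {l..<Suc k}"
      using step.hyps by auto
    then have "u_pairs {l..<Suc (Suc k)} = add_mset (x (2 * Suc k), x (2 * Suc k + 1)) (u_pairs {l..<Suc k})"
      "v_pairs {l..<Suc k} = add_mset (x (2 * k + 1), x (2 * k + 2)) (v_pairs {l..<k})"
      by (simp_all add: u_pairs_def v_pairs_def)
    then show ?case using step.IH by simp
  qed
  from this[of "e - 1"] assms show ?thesis
    by (simp add: algebra_simps Suc_diff_Suc numeral_2_eq_2)
qed

lemma nested_width:
  assumes "l < e"
  shows "x (2 * e - 1) - x (2 * l)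
    = sum u {l..<e} + sum v {l..<e - 1} + 2 * int (e - l) - 1"
proof -
  have "x (2 * k + 1) - x (2 * l) = sum u {l..<Suc k} + sum v {l..<k} + 2 * int (Suc k - l) - 1"
    if "l \<le> k" for k
    using that by (induction k rule: dec_induct) (auto simp: u_def v_def)
  from this[of "e - 1"] assms show ?thesis
    by (simp add: algebra_simps Suc_diff_Suc numeral_2_eq_2)
qed

text \<open>The budget for all cases: \<open>2 * m - 1\<close> gaps within a span of
  \<open>4 * m - 4\<close> leave \<open>2 * m - 3\<close> after each is reduced by 1.\<close>

lemma sum_gaps: "sum u {..<m} + sum v {..<m - 1} \<le> 2 * int m - 3"
  using nested_width[of 0 m] span large by (simp add: lessThan_atLeast0)

lemma sum_u: "sum u {..<m} \<le> 2 * int m - 3"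
proof -
  have "0 \<le> sum v {..<m - 1}" by (intro sum_nonneg) (auto intro: v_nonneg)
  with sum_gaps show ?thesis by linarith
qed

section \<open>Three cases according to the gaps \<open>u\<close> inside the pairs\<close>

lemma splits_if_moderate:
  assumes "\<And>i. i < m \<Longrightarrow> u i < int m" and "i < m" "u i = 0"
    and "even (\<Sum>\<^sub># (flat (u_pairs {..<m})))"
  shows "splits (flat (u_pairs {..<m})) 0"
proof -
  have "steers (flat (u_pairs {..<m})) (int (size (u_pairs {..<m})) + 1)"
  proof (rule steers_flat_if_one_narrow)
    fix p assume "p \<in># u_pairs {..<m}"
    then obtain i where "i < m" "width p = u i + 1" using width_u_pairs by blast
    then show "1 \<le> width p" "width p \<le> int (size (u_pairs {..<m}))"
      using u_nonneg assms(1) by force+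
  next
    show "excess (u_pairs {..<m}) < 2 * int (size (u_pairs {..<m})) - 2"
      using sum_u by simp
    show "(x (2 * i), x (2 * i + 1)) \<in># u_pairs {..<m}"
      using \<open>i < m\<close> by (auto simp: u_pairs_def)
    show "width (x (2 * i), x (2 * i + 1)) = 1"
      using \<open>u i = 0\<close> by (simp add: width_def u_def)
  qed
  from steers_splits_zero[OF this splits_empty] assms(4) show ?thesis by simp
qed

text \<open>The \<open>u i\<close> use at least \<open>m\<close> of the budget, so some
  \<open>v i\<close> is 0. If every such place had \<open>u i + u (Suc i) >= m - 2\<close>, one of
  them would leave at most 1 for the \<open>v\<close> gaps; then a second, disjoint place exists,
  and both together exceed the budget.\<close>

lemma exists_mergeable:
  assumes "\<And>i. i < m \<Longrightarrow> 1 \<le> u i"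
  shows "\<exists>i. Suc i < m \<and> v i = 0 \<and> u i + u (Suc i) \<le> int m - 3"
proof (rule ccontr)
  assume "\<not> ?thesis"
  then have bad: "int m - 2 \<le> u i + u (Suc i)" if "Suc i < m" "v i = 0" for i
    using that by force
  have sum_v_ge: "int (card B) \<le> sum v {..<m - 1}"
    if "B \<subseteq> {..<m - 1}" "\<And>i. i \<in> B \<Longrightarrow> v i \<noteq> 0" for B
  proof -
    have "int (card B) = (\<Sum>i\<in>B. 1)" by simp
    also have "\<dots> \<le> sum v B" using that v_nonneg
      by (intro sum_mono) (force simp: int_one_le_iff_zero_less order_less_le)
    also have "\<dots> \<le> sum v {..<m - 1}"
      using that v_nonneg by (intro sum_mono2) auto
    finally show ?thesis .
  qed
  have sum_u_ge: "sum u A + int m - int (card A) \<le> sum u {..<m}" if "A \<subseteq> {..<m}" for A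
  proof -
    have "int (card ({..<m} - A)) = (\<Sum>i\<in>{..<m} - A. 1)" by simp
    also have "\<dots> \<le> sum u ({..<m} - A)" using assms by (intro sum_mono) auto
    also have "\<dots> = sum u {..<m} - sum u A" using that by (simp add: sum_diff)
    finally show ?thesis
      using that card_mono[OF _ that] by (simp add: card_Diff_subset finite_subset[OF that])
  qed
  have "\<exists>i. Suc i < m \<and> v i = 0"
  proof (rule ccontr)
    assume "\<not> ?thesis"
    then have "int (card {..<m - 1}) \<le> sum v {..<m - 1}"
      by (intro sum_v_ge) (auto simp: less_diff_conv)
    moreover have "int m \<le> sum u {..<m}" using sum_u_ge[of "{}"] by simp
    ultimately show False using sum_gaps large by simp
  qed
  then obtain i where i: "Suc i < m" "v i = 0" by blast
  have "2 * int m - 4 \<le> sum u {..<m}"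
    using sum_u_ge[of "{i, Suc i}"] bad[OF i] i by simp
  then have few: "sum v {..<m - 1} \<le> 1" using sum_gaps by linarith
  have "\<exists>j. Suc j < m \<and> v j = 0 \<and> (Suc i < j \<or> Suc j < i)"
  proof (rule ccontr)
    assume *: "\<not> ?thesis"
    \<comment> \<open>The removed indices are those \<open>k\<close> for which
      \<open>{k, Suc k}\<close> can meet \<open>{i, Suc i}\<close>.\<close>
    define B where "B = {..<m - 1} - {i - 1, i, Suc i}"
    have "int (card B) \<le> sum v {..<m - 1}"
    proof (rule sum_v_ge)
      show "v k \<noteq> 0" if "k \<in> B" for k
        using that spec[OF *[simplified], of k] by (auto simp: B_def less_diff_conv)
    qed (auto simp: B_def)
    moreover have "m - 1 - 3 \<le> card B"
    proof -
      have "card {i - 1, i, Suc i} \<le> 3" by (auto simp: card_insert_if)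
      then show ?thesis unfolding B_def
        using diff_card_le_card_Diff[of "{i - 1, i, Suc i}" "{..<m - 1}"] by simp
    qed
    ultimately show False using few large by linarith
  qed
  then obtain j where j: "Suc j < m" "v j = 0" "Suc i < j \<or> Suc j < i" by blast
  have "sum u {i, Suc i, j, Suc j} = u i + u (Suc i) + u j + u (Suc j)"
    "card {i, Suc i, j, Suc j} = 4"
    using j by auto
  then show False
    using sum_u_ge[of "{i, Suc i, j, Suc j}"] bad[OF i] bad[OF j(1,2)] i j sum_u large by auto
qed

text \<open>Pairing four entries as inner and outer pair creates a pair of width 1, and the other
  pairs then satisfy the criterion with one narrow pair. The outer pair is used before all of
  them.\<close>

lemma splits_if_all_wide:
  assumes "\<And>i. i < m \<Longrightarrow> 1 \<le> u i"
    and "even (\<Sum>\<^sub># (flat (u_pairs {..<m})))"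
  shows "splits (flat (u_pairs {..<m})) 0"
proof -
  obtain i where i: "Suc i < m" "v i = 0" "u i + u (Suc i) \<le> int m - 3"
    using exists_mergeable[OF assms(1)] by blast
  define A where "A = {..<m} - {i, Suc i}"
  define P where "P = u_pairs A + v_pairs {i}"
  have A: "{..<m} = A \<union> {i..<i + 2}" "A \<inter> {i..<i + 2} = {}" "finite A"
    using i by (auto simp: A_def)
  have "card A = m - 2" using i by (simp add: A_def card_Diff_subset)
  then have size: "int (size P) = int m - 1" using large by (simp add: P_def)
  have sum_A: "sum u {..<m} = sum u A + u i + u (Suc i)"
    unfolding A(1) using A(2,3) by (subst sum.union_disjoint) auto
  have narrow: "(x (2 * i + 1), x (2 * i + 2)) \<in># P" "width (x (2 * i + 1), x (2 * i + 2)) = 1"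
    using i(2) by (auto simp: P_def v_pairs_def width_def v_def)
  have "steers (flat P) (int (size P) + 1)"
  proof (rule steers_flat_if_one_narrow[OF _ _ _ narrow])
    fix p assume "p \<in># P"
    then consider j where "j \<in> A" "width p = u j + 1" | "width p = v i + 1"
      using width_u_pairs[OF A(3)] width_v_pairs[of "{i}"] unfolding P_def by fastforce
    then have "1 \<le> width p \<and> width p \<le> int (size P)"
    proof cases
      case (1 j)
      then have "j < m" by (simp add: A_def)
      \<comment> \<open>All other \<open>u\<close> are at least 1, which leaves at most
        \<open>m - 2\<close> of the budget for \<open>u j\<close>.\<close>
      have "int (card (A - {j})) \<le> sum u (A - {j})"
        using assms(1) sum_bounded_below[of "A - {j}" 1 u] by (simp add: A_def)
      moreover have "sum u A = u j + sum u (A - {j})" using 1 A(3) by (simp add: sum.remove)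
      moreover have "int (card (A - {j})) = int m - 3"
        using 1 A(3) \<open>card A = m - 2\<close> large by simp
      ultimately have "u j \<le> int m - 2"
        using sum_A sum_u assms(1)[of i] assms(1)[of "Suc i"] i(1) by simp
      then show ?thesis using 1 size assms(1)[OF \<open>j < m\<close>] by simp
    next
      case 2
      then show ?thesis using i(2) size large by simp
    qed
    then show "1 \<le> width p" "width p \<le> int (size P)" by auto
  next
    show "excess P < 2 * int (size P) - 2"
      using sum_A sum_u assms(1)[of i] assms(1)[of "Suc i"] i size by (simp add: P_def)
  qed
  moreover have "x (2 * i + 3) - x (2 * i) = u i + v i + u (Suc i) + 3"
    by (simp add: u_def v_def numeral_3_eq_3)
  moreover have "x (2 * i) < x (2 * i + 3)" using strict i(1) by simp
  \<comment> \<open>The outer width is at most \<open>(m - 3) + 3 = m\<close>, which is exactly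
    \<open>size P + 1\<close>.\<close>
  ultimately have "steers (flat P + {#x (2 * i), x (2 * i + 3)#}) (int (size P) + 1 + 1)"
    using i size by (intro steers_add_pair) auto
  moreover have "flat (u_pairs {..<m}) = flat P + {#x (2 * i), x (2 * i + 3)#}"
  proof -
    have "u_pairs {..<m} = u_pairs A + u_pairs {i..<i + 2}"
      using A by (simp add: u_pairs_Un)
    then show ?thesis
      using flat_u_pairs_nested[of i "i + 2"] by (simp add: P_def numeral_3_eq_3)
  qed
  ultimately show ?thesis
    using steers_splits_zero[OF _ splits_empty] assms(2) size by fastforce
qed

text \<open>Here \<open>h\<close> is the wide pair, and the blocks \<open>l..h - 1\<close> and
  \<open>h + 1..j\<close> are re-paired, each nonempty one giving a long pair. \<open>D\<close> is
  the total width of the long pairs and \<open>r\<close> counts the short pairs. The wide pair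
  against the long ones gives the starting difference, which the short pairs steer to 0.\<close>

lemma splits_nested:
  assumes h: "l \<le> h" "h \<le> j" "j < m"
    and D: "D = (if l < h then x (2 * h - 1) - x (2 * l) else 0)
              + (if h < j then x (2 * j + 1) - x (2 * h + 2) else 0)"
    and r: "r = m - 1 - of_bool (l < h) - of_bool (h < j)"
    and rest: "2 * int m - 3 - u h < int r"
    and balance: "\<bar>u h + 1 - D\<bar> \<le> int r + 1"
    and even: "even (\<Sum>\<^sub># (flat (u_pairs {..<m})))"
  shows "splits (flat (u_pairs {..<m})) 0"
proof -
  define P where "P = u_pairs {..<l} + v_pairs {l..<h - 1} + v_pairs {h + 1..<j} + u_pairs {j + 1..<m}"
  define L where "L = (if l < h then {#x (2 * l), x (2 * h - 1)#} else {#})"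
  define H where "H = (if h < j then {#x (2 * h + 2), x (2 * j + 1)#} else {#})"
  have "u_pairs {..<m} = u_pairs {..<l} + (u_pairs {l..<h} + (u_pairs {h} +
      (u_pairs {h + 1..<j + 1} + u_pairs {j + 1..<m})))"
    using h u_pairs_concat[of 0 l m] u_pairs_concat[of l h m] u_pairs_concat[of h "h + 1" m]
      u_pairs_concat[of "h + 1" "j + 1" m]
    by (simp add: lessThan_atLeast0)
  moreover have "flat (u_pairs {l..<h}) = flat (v_pairs {l..<h - 1}) + L"
    using flat_u_pairs_nested[of l h] by (auto simp: L_def u_pairs_def v_pairs_def)
  moreover have "flat (u_pairs {h + 1..<j + 1}) = flat (v_pairs {h + 1..<j}) + H"
    using flat_u_pairs_nested[of "h + 1" "j + 1"] by (auto simp: H_def u_pairs_def v_pairs_def)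
  ultimately have decomp: "flat (u_pairs {..<m}) = flat P + ({#x (2 * h + 1), x (2 * h)#} + L + H)"
    by (simp add: P_def u_pairs_def)
  have size: "size P = r"
    using h by (auto simp: P_def r)
  have "steers (flat P) (int (size P) + 1)"
  proof (rule steers_flat_if_excess_small)
    fix p assume "p \<in># P"
    then have "(\<exists>i\<in>{..<l} \<union> {j + 1..<m}. width p = u i + 1)
        \<or> (\<exists>i\<in>{l..<h - 1} \<union> {h + 1..<j}. width p = v i + 1)"
      using width_u_pairs width_v_pairs unfolding P_def
      by (metis Un_iff finite_atLeastLessThan finite_lessThan union_iff)
    then show "1 \<le> width p"
    proof (elim disjE bexE)
      fix i assume "i \<in> {..<l} \<union> {j + 1..<m}" "width p = u i + 1"
      then show ?thesis using h u_nonneg[of i] by auto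
    next
      fix i assume "i \<in> {l..<h - 1} \<union> {h + 1..<j}" "width p = v i + 1"
      then show ?thesis using h v_nonneg[of i] by auto
    qed
  next
    \<comment> \<open>The short pairs and the wide pair use disjoint gaps, so the excess of the
      short ones is at most \<open>2 * m - 3 - u h\<close>.\<close>
    have "sum u ({..<l} \<union> ({h} \<union> {j + 1..<m})) \<le> sum u {..<m}"
      using h u_nonneg by (intro sum_mono2) auto
    moreover have "sum u ({..<l} \<union> ({h} \<union> {j + 1..<m})) = sum u {..<l} + (u h + sum u {j + 1..<m})"
      using h by (subst sum.union_disjoint; force)+
    moreover have "sum v ({l..<h - 1} \<union> {h + 1..<j}) \<le> sum v {..<m - 1}"
      using h v_nonneg by (intro sum_mono2) auto
    moreover have "sum v ({l..<h - 1} \<union> {h + 1..<j}) = sum v {l..<h - 1} + sum v {h + 1..<j}"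
      using h by (intro sum.union_disjoint) auto
    ultimately show "excess P < int (size P)"
      using rest sum_gaps size by (simp add: P_def)
  qed
  \<comment> \<open>the long pairs are oriented against the wide gap\<close>
  moreover have "splits ({#x (2 * h + 1), x (2 * h)#} + L + H) (u h + 1 - D)"
  proof -
    have "splits L (if l < h then x (2 * l) - x (2 * h - 1) else 0)"
      "splits H (if h < j then x (2 * h + 2) - x (2 * j + 1) else 0)"
      using splits_pair splits_empty by (auto simp: L_def H_def)
    from splits_add[OF splits_add[OF splits_pair[of "x (2 * h + 1)" "x (2 * h)"] this(1)] this(2)]
    show ?thesis unfolding D by (simp add: u_def algebra_simps split: if_splits)
  qed
  ultimately show ?thesis
    unfolding decomp using even[unfolded decomp] balance size by (intro steers_splits_zero) auto
qed

text \<open>The wide gap uses so much of the budget that the long pairs have nearly predictable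
  width; \<open>l\<close> and \<open>j\<close> are chosen so that \<open>D\<close> is close enough
  to \<open>u h + 1\<close>.\<close>

lemma splits_if_wide_gap:
  assumes "h < m" "int m \<le> u h"
    and even: "even (\<Sum>\<^sub># (flat (u_pairs {..<m})))"
  shows "splits (flat (u_pairs {..<m})) 0"
proof -
  \<comment> \<open>The lower bound counts the gaps spanned by the long pairs; one more is spanned
    if all lie on one side of \<open>h\<close>. The slack is the budget left over by
    \<open>u h\<close>.\<close>
  have D_bounds: "2 * int (j - l) - 2 + of_bool (l = h \<or> h = j) \<le> D \<and>
      D \<le> 2 * int (j - l) - 2 + of_bool (l = h \<or> h = j) + (2 * int m - 3 - u h)"
    if h: "l \<le> h" "h \<le> j" "l < j" "j < m"
      and D: "D = (if l < h then x (2 * h - 1) - x (2 * l) else 0)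
              + (if h < j then x (2 * j + 1) - x (2 * h + 2) else 0)" for l j D
  proof -
    define U where "U = sum u {l..<h} + sum u {h + 1..<j + 1}"
    define V where "V = sum v {l..<h - 1} + sum v {h + 1..<j}"
    have "D = U + V + 2 * int (j - l) - 2 + of_bool (l = h \<or> h = j)"
      using nested_width[of l h] nested_width[of "h + 1" "j + 1"] h
      by (auto simp: D U_def V_def)
    moreover have "0 \<le> U" "0 \<le> V"
      unfolding U_def V_def using h by (auto intro!: add_nonneg_nonneg sum_nonneg u_nonneg v_nonneg)
    moreover have "sum u ({l..<h} \<union> ({h} \<union> {h + 1..<j + 1})) \<le> sum u {..<m}"
      using h u_nonneg by (intro sum_mono2) auto
    moreover have "sum u ({l..<h} \<union> ({h} \<union> {h + 1..<j + 1})) = U + u h"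
      unfolding U_def using h by ((subst sum.union_disjoint; force)+)?
    moreover have "sum v ({l..<h - 1} \<union> {h + 1..<j}) \<le> sum v {..<m - 1}"
      using h v_nonneg by (intro sum_mono2) auto
    moreover have "sum v ({l..<h - 1} \<union> {h + 1..<j}) = V"
      unfolding V_def using h by (intro sum.union_disjoint) auto
    ultimately show ?thesis using sum_gaps by linarith
  qed
  have "u h \<le> sum u {..<m}" using assms u_nonneg by (intro member_le_sum) auto
  then have u_le: "u h \<le> 2 * int m - 3" using sum_u by linarith
  show ?thesis
  proof (cases "u h = int m")
    case True
    \<comment> \<open>The excess can be as large as \<open>m - 3\<close>, so \<open>r\<close> must
      be at least \<open>m - 2\<close> and only one long pair is allowed. A block of two pairs gives
      \<open>3 <= D <= m\<close>, hence a difference between 1 and \<open>m - 2\<close>.\<close>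
    consider "2 \<le> h" | "h + 2 < m" using large by linarith
    then obtain l j where lj: "l \<le> h" "h \<le> j" "j < m" "l = h \<or> h = j" "j - l = 2"
    proof cases
      case 1 then show ?thesis using that[of "h - 2" h] assms(1) by simp
    next
      case 2 then show ?thesis using that[of h "h + 2"] by simp
    qed
    define r where "r = m - 1 - of_bool (l < h) - of_bool (h < j)"
    have r: "int r = int m - 2" using lj large by (auto simp: r_def)
    show ?thesis
      by (rule splits_nested[OF lj(1-3) refl r_def _ _ even])
        (use True r D_bounds[OF lj(1,2) _ lj(3) refl] lj large in auto)
  next
    case False
    \<comment> \<open>the long pairs span between \<open>m\<close> and \<open>m + 2\<close> gaps, on whichever sides there is room\<close>
    define c where "c = (m + 3) div 2"
    obtain l j where lj: "l \<le> h" "h \<le> j" "j < m" "j = l + c"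
    proof (cases "h + c < m")
      case True then show ?thesis using that[of h "h + c"] by simp
    next
      \<comment> \<open>Without room to the right, the last \<open>c + 1\<close> indices are taken;
        \<open>h\<close> is among them because \<open>h + c >= m\<close>.\<close>
      case False then show ?thesis
        using that[of "m - 1 - c" "m - 1"] assms(1) large by (simp add: c_def)
    qed
    define r where "r = m - 1 - of_bool (l < h) - of_bool (h < j)"
    have r: "int m - 3 \<le> int r" using lj large by (auto simp: r_def)
    have c: "int m + 2 \<le> 2 * int c" "2 * int c \<le> int m + 3" "0 < c" by (auto simp: c_def)
    define D where "D = (if l < h then x (2 * h - 1) - x (2 * l) else 0)
              + (if h < j then x (2 * j + 1) - x (2 * h + 2) else 0)"
    \<comment> \<open>As \<open>m + 1 <= u h <= 2 * m - 3\<close>, these bounds put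
      \<open>u h + 1 - D\<close> between \<open>4 - m\<close> and \<open>m - 2\<close>, within reach
      even with two long pairs.\<close>
    have "2 * int c - 2 \<le> D" "D \<le> 2 * int c - 1 + (2 * int m - 3 - u h)"
      using D_bounds[OF lj(1,2) _ lj(3) D_def] lj(4) c(3) by (auto simp: of_bool_def split: if_splits)
    then show ?thesis
      using False assms(2) r c u_le by (intro splits_nested[OF lj(1-3) D_def r_def _ _ even]) auto
  qed
qed

lemma splits_image:
  assumes "even (sum x {..<2 * m})"
  shows "splits (image_mset x (mset_set {..<2 * m})) 0"
proof -
  have *: "even (\<Sum>\<^sub># (flat (u_pairs {..<m})))"
    using assms unfolding flat_u_pairs by (simp add: sum_unfold_sum_mset)
  show ?thesis
    unfolding flat_u_pairs[symmetric]
    using splits_if_moderate[OF _ _ _ *] splits_if_all_wide[OF _ *] splits_if_wide_gap[OF _ _ *]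
      u_nonneg by (metis int_one_le_iff_zero_less linorder_le_less_linear order_less_le)
qed

end

section \<open>From sequences to sets and multisets of integers\<close>

lemma splits_mset_set:
  fixes X :: "int set"
  assumes "finite X" "card X = 2 * m" "8 \<le> m" "X \<subseteq> {a..a + 4 * int m - 4}" "even (\<Sum>X)"
  shows "splits (mset_set X) 0"
proof -
  define xs where "xs = sorted_list_of_set X"
  define x where "x i = xs ! i" for i
  have len: "length xs = 2 * m" using assms by (simp add: xs_def)
  have mem: "x i \<in> X" if "i < 2 * m" for i
    using that len assms(1) nth_mem[of i xs] by (simp add: x_def xs_def)
  have sorted: "sorted_wrt (<) xs" by (simp add: xs_def)
  interpret spread_sequence x m
  proof
    show "x i < x j" if "i < j" "j < 2 * m" for i j
      using that sorted len by (simp add: x_def sorted_wrt_nth_less)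
    have "{x (2 * m - 1), x 0} \<subseteq> {a..a + 4 * int m - 4}"
      using mem[of "2 * m - 1"] mem[of 0] assms(3,4) by auto
    then show "x (2 * m - 1) - x 0 \<le> 4 * int m - 4" by simp
  qed (fact assms)
  have "image_mset x (mset_set {..<2 * m}) = mset (map x [0..<2 * m])"
    by (simp add: lessThan_atLeast0)
  also have "map x [0..<2 * m] = xs"
    using map_nth[of xs] len by (simp add: x_def[abs_def])
  finally have *: "image_mset x (mset_set {..<2 * m}) = mset_set X"
    using mset_sorted_list_of_multiset[of "mset_set X"] by (simp add: xs_def)
  have "sum x {..<2 * m} = \<Sum>X"
    using * by (simp add: sum_unfold_sum_mset)
  with splits_image * assms(5) show ?thesis by simp
qed

text \<open>Adding a copy of \<open>x\<close> toggles its membership in the odd set; when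
  \<open>x\<close> leaves that set, its two copies become one more element of
  \<open>K\<close>.\<close>

lemma mset_pair_off: "\<exists>K. N = K + K + mset_set {x. odd (count N x)}"
proof (induction N)
  case (add x N)
  define Odds where "Odds = {y. odd (count N y)}"
  have fin: "finite Odds"
    by (rule finite_subset[of _ "set_mset N"]) (auto simp: Odds_def intro: ccontr simp: not_in_iff)
  from add obtain K where K: "N = K + K + mset_set Odds" by (auto simp: Odds_def)
  show ?case
  proof (cases "x \<in> Odds")
    case True
    then have "{y. odd (count (add_mset x N) y)} = Odds - {x}"
      by (auto simp: Odds_def)
    moreover have "mset_set Odds = add_mset x (mset_set (Odds - {x}))"
      using fin True by (simp add: mset_set.remove)
    ultimately show ?thesis
      using K by (intro exI[of _ "add_mset x K"]) simp
  next
    case False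
    then have "{y. odd (count (add_mset x N) y)} = insert x Odds"
      by (auto simp: Odds_def)
    then show ?thesis using K fin False by (intro exI[of _ K]) simp
  qed
qed (auto intro: exI[of _ "{#}"])

lemma splits_if_many_odd_counts:
  fixes N :: "int multiset"
  assumes "even (size N)" "32 \<le> size N" "set_mset N \<subseteq> {1..int (size N) - 1}" "even (\<Sum>\<^sub># N)"
    and "size N < 2 * card {x. odd (count N x)} \<or> {x. odd (count N x)} = {}"
  shows "splits N 0"
proof -
  define X where "X = {x. odd (count N x)}"
  obtain K where K: "N = K + K + mset_set X" using mset_pair_off unfolding X_def by blast
  have X: "X \<subseteq> set_mset N" by (auto simp: X_def intro: ccontr simp: not_in_iff)
  then have fin: "finite X" by (rule finite_subset) simp
  have "splits (mset_set X) 0"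
  proof (cases "X = {}")
    case True
    then show ?thesis using splits_empty by simp
  next
    case False
    then have less: "size N < 2 * card X" using assms(5) unfolding X_def by blast
    have "even (card X)" using assms(1) K by simp
    then obtain m where m: "card X = 2 * m" by blast
    \<comment> \<open>Evenness improves \<open>size N < 4 * m\<close> by one more, so that
      \<open>{1..size N - 1}\<close> has span at most \<open>4 * m - 4\<close>.\<close>
    have "int (size N) \<le> 4 * int m - 2" using less m assms(1) by presburger
    then have "X \<subseteq> {1..1 + 4 * int m - 4}" using X assms(3) by force
    moreover have "even (\<Sum>X)"
      using assms(4) K by (simp add: sum_unfold_sum_mset)
    ultimately show ?thesis
      using fin m less assms(2) by (intro splits_mset_set[of X m 1]) auto
  qed
  from splits_add[OF splits_double[of K] this] K show ?thesis by simp
qed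

section \<open>Graphs of diameter 2\<close>

lemma mset_set_set_mset_if_count_le_1:
  assumes "\<And>v. count A v \<le> 1" shows "mset_set (set_mset A) = A"
proof (rule multiset_eqI)
  show "count (mset_set (set_mset A)) v = count A v" for v
    using assms[of v] count_greater_zero_iff[of A v] by (auto simp: count_mset_set' simp del: count_greater_zero_iff)
qed

context graph
begin

lemma adj_sym: "u \<rightarrow> v \<longleftrightarrow> v \<rightarrow> u"
  using sym_arcs by (metis symD symmetric_def)

lemma gdist_adjacent:
  assumes "u \<rightarrow> v" shows "gdist u v = 1"
proof (rule antisym)
  from assms obtain e where e: "e \<in> arcs G" "tail G e = u" "head G e = v" by auto
  then have "awalk u [e] v" by (auto simp: awalk_Cons_iff awalk_Nil_iff)
  from min_cost_le_walk_cost[OF this, of "\<lambda>_. 1"]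
  show "gdist u v \<le> 1" by (simp add: gdist_def awalk_cost_unit one_ereal_def)
  show "1 \<le> gdist u v"
    unfolding gdist_def \<mu>_def
  proof (rule INF_greatest)
    fix p assume "p \<in> {p. awalk u p v}"
    moreover have "u \<noteq> v" using assms adj_not_same by blast
    ultimately have "1 \<le> length p" by (cases p) (auto simp: awalk_Nil_iff)
    then show "1 \<le> ereal (awalk_cost (\<lambda>_. 1) p)"
      by (simp add: awalk_cost_unit one_ereal_def)
  qed
qed

lemma gdist_nonadjacent:
  assumes "u \<noteq> v" "\<not> u \<rightarrow> v" shows "2 \<le> gdist u v"
  unfolding gdist_def \<mu>_def
proof (rule INF_greatest)
  fix p assume "p \<in> {p. awalk u p v}"
  then have p: "awalk u p v" by simp
  have "2 \<le> length p"
  proof (cases p)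
    case Nil
    then show ?thesis using p assms by (simp add: awalk_Nil_iff)
  next
    case (Cons e q)
    then have "e \<in> arcs G" "u = tail G e" "awalk (head G e) q v"
      using p by (auto simp: awalk_Cons_iff)
    then have "q \<noteq> []" using assms(2) by (auto simp: awalk_Nil_iff arcs_ends_conv)
    then show ?thesis using Cons by (cases q) auto
  qed
  then have "2 \<le> real (length p)" by simp
  then show "2 \<le> ereal (awalk_cost (\<lambda>_. 1) p)"
    by (simp add: awalk_cost_unit)
qed

text \<open>Two-element sets count each edge once although it consists of two arcs.\<close>

definition inner_edges :: "'a set \<Rightarrow> 'a set set" where
  "inner_edges S = {e. e \<subseteq> S \<and> card e = 2 \<and> (\<exists>u v. e = {u, v} \<and> u \<rightarrow> v)}"

lemma finite_inner_edges: "finite S \<Longrightarrow> finite (inner_edges S)"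
  by (rule finite_subset[of _ "Pow S"]) (auto simp: inner_edges_def)

lemma inner_edges_insert:
  assumes "z \<notin> S"
  shows "inner_edges (insert z S) = inner_edges S \<union> (\<lambda>w. {z, w}) ` {w \<in> S. z \<rightarrow> w}"
proof (intro equalityI subsetI)
  fix e assume "e \<in> inner_edges (insert z S)"
  then obtain u v where e: "e = {u, v}" "u \<rightarrow> v" "e \<subseteq> insert z S" "card e = 2"
    by (auto simp: inner_edges_def)
  then have "u \<noteq> v" using adj_not_same by blast
  consider "u \<in> S" "v \<in> S" | "u = z" "v \<in> S" | "u \<in> S" "v = z"
    using e \<open>u \<noteq> v\<close> by auto
  then show "e \<in> inner_edges S \<union> (\<lambda>w. {z, w}) ` {w \<in> S. z \<rightarrow> w}"
  proof cases
    case 1 then show ?thesis using e by (auto simp: inner_edges_def)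
  next
    case 2 then show ?thesis using e by auto
  next
    case 3
    then have "e = {z, u}" "u \<in> {w \<in> S. z \<rightarrow> w}" using e adj_sym by auto
    then show ?thesis by blast
  qed
next
  fix e assume "e \<in> inner_edges S \<union> (\<lambda>w. {z, w}) ` {w \<in> S. z \<rightarrow> w}"
  moreover have "z \<noteq> w" if "w \<in> S" for w using assms that by blast
  ultimately show "e \<in> inner_edges (insert z S)"
    by (auto simp: inner_edges_def)
qed

text \<open>The handshake lemma for the induced subgraph: a new vertex with \<open>d\<close>
  neighbours in \<open>S\<close> contributes \<open>d\<close> itself and 1 at each of these
  neighbours.\<close>

lemma sum_inner_degrees:
  assumes "finite S"
  shows "(\<Sum>v\<in>S. card {w \<in> S. v \<rightarrow> w}) = 2 * card (inner_edges S)"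
  using assms
proof (induction S)
  case empty
  have "inner_edges {} = {}" by (auto simp: inner_edges_def)
  then show ?case by simp
next
  case (insert z S)
  define d where "d = card {w \<in> S. z \<rightarrow> w}"
  have "{w \<in> insert z S. z \<rightarrow> w} = {w \<in> S. z \<rightarrow> w}" using adj_not_same by auto
  moreover have "card {w \<in> insert z S. v \<rightarrow> w} = card {w \<in> S. v \<rightarrow> w} + of_bool (z \<rightarrow> v)"
    if "v \<in> S" for v
  proof -
    have "{w \<in> insert z S. v \<rightarrow> w} = {w \<in> S. v \<rightarrow> w} \<union> (if z \<rightarrow> v then {z} else {})"
      using adj_sym by auto
    then show ?thesis using insert by simp
  qed
  moreover have "(\<Sum>v\<in>S. of_bool (z \<rightarrow> v)) = d"
    using insert.hyps(1) by (simp add: d_def sum.If_cases Int_def of_bool_def)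
  ultimately have "(\<Sum>v\<in>insert z S. card {w \<in> insert z S. v \<rightarrow> w}) = 2 * d + 2 * card (inner_edges S)"
    using insert by (simp add: sum.distrib d_def)
  moreover have "card (inner_edges (insert z S)) = card (inner_edges S) + d"
  proof -
    have "inner_edges S \<inter> (\<lambda>w. {z, w}) ` {w \<in> S. z \<rightarrow> w} = {}"
      using insert.hyps(2) by (auto simp: inner_edges_def)
    moreover have "inj_on (\<lambda>w. {z, w}) {w \<in> S. z \<rightarrow> w}"
      by (auto simp: inj_on_def doubleton_eq_iff)
    ultimately show ?thesis
      using insert.hyps by (simp add: inner_edges_insert card_Un_disjoint finite_inner_edges
          card_image d_def)
  qed
  ultimately show ?case by simp
qed

lemma out_degree_eq_card_neighbours: "out_degree G v = card {w \<in> verts G. v \<rightarrow> w}"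
proof -
  have "inj_on (head G) (out_arcs G v)"
    using no_multi_arcs by (auto simp: inj_on_def arc_to_ends_def)
  moreover have "head G ` out_arcs G v = {w \<in> verts G. v \<rightarrow> w}"
    by (force simp: arcs_ends_conv)
  ultimately show ?thesis unfolding out_degree_def by (metis card_image)
qed

text \<open>Edges between \<open>S\<close> and \<open>T\<close> contribute equally to both degree
  sums and cancel. The additive form avoids subtraction on naturals.\<close>

lemma sum_degrees_partition:
  assumes "S \<union> T = verts G" "S \<inter> T = {}"
  shows "(\<Sum>v\<in>S. out_degree G v) + 2 * card (inner_edges T)
    = (\<Sum>v\<in>T. out_degree G v) + 2 * card (inner_edges S)"
proof -
  have fin: "finite S" "finite T"
    using assms finite_verts by (metis finite_Un)+
  have deg: "out_degree G v = card {w \<in> S. v \<rightarrow> w} + card {w \<in> T. v \<rightarrow> w}" for v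
  proof -
    have "{w \<in> verts G. v \<rightarrow> w} = {w \<in> S. v \<rightarrow> w} \<union> {w \<in> T. v \<rightarrow> w}" using assms by auto
    moreover have "{w \<in> S. v \<rightarrow> w} \<inter> {w \<in> T. v \<rightarrow> w} = {}" using assms by auto
    ultimately show ?thesis
      using fin by (simp add: out_degree_eq_card_neighbours card_Un_disjoint)
  qed
  have card_sum: "card {w \<in> A. v \<rightarrow> w} = (\<Sum>w\<in>A. of_bool (v \<rightarrow> w))" if "finite A" for A v
    using that by (simp add: sum.If_cases Int_def of_bool_def)
  have "(\<Sum>v\<in>S. card {w \<in> T. v \<rightarrow> w}) = (\<Sum>v\<in>S. \<Sum>w\<in>T. of_bool (v \<rightarrow> w))"
    by (simp only: card_sum[OF fin(2)])
  also have "\<dots> = (\<Sum>w\<in>T. \<Sum>v\<in>S. of_bool (w \<rightarrow> v))"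
    by (subst sum.swap) (subst adj_sym, rule refl)
  also have "\<dots> = (\<Sum>w\<in>T. card {v \<in> S. w \<rightarrow> v})"
    by (simp only: card_sum[OF fin(1)])
  finally show ?thesis
    using sum_inner_degrees fin by (simp add: deg sum.distrib)
qed

lemma even_sum_degrees: "even (\<Sum>v\<in>verts G. out_degree G v)"
  using sum_inner_degrees[OF finite_verts] by (simp add: out_degree_eq_card_neighbours)

lemma homometric_number_eqI:
  assumes "h \<in> homometric_sizes" "card (verts G) \<le> 2 * h"
  shows "homometric_number = h"
  unfolding homometric_number_def
proof (rule Max_eqI[OF finite_homometric_sizes _ assms(1)])
  fix k assume "k \<in> homometric_sizes"
  then obtain S T where ST: "S \<subseteq> verts G" "T \<subseteq> verts G" "S \<inter> T = {}" "card S = k" "card T = k"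
    by (auto simp: homometric_sizes_def)
  then have "card (S \<union> T) = 2 * k"
    using finite_subset[OF _ finite_verts] by (subst card_Un_disjoint) auto
  moreover have "card (S \<union> T) \<le> card (verts G)"
    using ST by (intro card_mono) auto
  ultimately show "k \<le> h" using assms(2) by linarith
qed

section \<open>Consequences of diameter 2\<close>

context
  assumes diameter: "diameter = 2"
begin

lemma gdist_le_2: "u \<in> verts G \<Longrightarrow> v \<in> verts G \<Longrightarrow> gdist u v \<le> 2"
  unfolding diameter[symmetric] diameter_def
  by (rule SUP_upper2, assumption, rule SUP_upper)

lemma pair_dist_eq_if:
  assumes "e \<subseteq> S" "S \<subseteq> verts G" "card e = 2"
  shows "pair_dist e = (if e \<in> inner_edges S then 1 else 2)"
proof -
  obtain u v where e: "e = {u, v}" "u \<noteq> v" using assms(3) by (meson card_2_iff)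
  then have uv: "u \<in> verts G" "v \<in> verts G" using assms by auto
  have "e \<in> inner_edges S \<longleftrightarrow> u \<rightarrow> v"
    using assms e adj_sym by (auto simp: inner_edges_def doubleton_eq_iff)
  then show ?thesis
    using gdist_adjacent gdist_nonadjacent[OF e(2)] gdist_le_2[OF uv]
    by (auto simp: e(1) pair_dist_eq intro: antisym)
qed

text \<open>Distances are 1 on edges and 2 on all other pairs, so only the size and the number of
  inner edges matter.\<close>

lemma distance_mset_eq:
  assumes "S \<subseteq> verts G"
  shows "distance_mset S = replicate_mset (card (inner_edges S)) 1
    + replicate_mset ((card S choose 2) - card (inner_edges S)) 2"
proof -
  define F where "F = {e. e \<subseteq> S \<and> card e = 2}"
  have "finite S" using assms finite_verts finite_subset by blast
  then have F: "finite F" "card F = card S choose 2"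
    unfolding F_def by (auto intro: finite_subset[of _ "Pow S"] simp: n_subsets)
  have sub: "inner_edges S \<subseteq> F" by (auto simp: inner_edges_def F_def)
  have "F = inner_edges S \<union> (F - inner_edges S)" using sub by auto
  then have "mset_set F = mset_set (inner_edges S) + mset_set (F - inner_edges S)"
    using F(1) sub by (metis Diff_disjoint finite_Diff finite_subset mset_set_Union)
  moreover have "image_mset pair_dist (mset_set (inner_edges S)) = image_mset (\<lambda>_. 1) (mset_set (inner_edges S))"
    using pair_dist_eq_if[OF _ assms] finite_inner_edges[OF \<open>finite S\<close>]
    by (intro image_mset_cong) (auto simp: inner_edges_def)
  moreover have "image_mset pair_dist (mset_set (F - inner_edges S)) = image_mset (\<lambda>_. 2) (mset_set (F - inner_edges S))"
    using pair_dist_eq_if[OF _ assms] F(1)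
    by (intro image_mset_cong) (auto simp: F_def)
  moreover have "card (F - inner_edges S) = card F - card (inner_edges S)"
    using sub F(1) by (meson card_Diff_subset finite_subset)
  ultimately show ?thesis
    using F(2) unfolding distance_mset_def F_def[symmetric] by (simp add: image_mset_const_eq)
qed

lemma out_degree_bounds:
  assumes "v \<in> verts G" "2 \<le> card (verts G)"
  shows "1 \<le> out_degree G v" "out_degree G v \<le> card (verts G) - 1"
proof -
  have "\<not> verts G \<subseteq> {v}" using assms(2) card_mono[of "{v}" "verts G"] by auto
  then obtain w where w: "w \<in> verts G" "w \<noteq> v" by auto
  \<comment> \<open>A finite distance yields a walk to \<open>w\<close>, whose first arc leaves
    \<open>v\<close>.\<close>
  have "gdist v w \<noteq> \<infinity>" using gdist_le_2[OF assms(1) w(1)] by auto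
  then have "v \<rightarrow>\<^sup>* w" using shortest_path_inf unfolding gdist_def by blast
  then obtain p where p: "awalk v p w" by (auto simp: reachable_awalk)
  then obtain e q where "p = e # q" using w(2) by (cases p) (auto simp: awalk_Nil_iff)
  then have "e \<in> arcs G" "tail G e = v" using p by (auto simp: awalk_Cons_iff)
  then have "head G e \<in> {w \<in> verts G. v \<rightarrow> w}" by (auto simp: arcs_ends_conv)
  then have "0 < card {w \<in> verts G. v \<rightarrow> w}" by (subst card_gt_0_iff) auto
  then show "1 \<le> out_degree G v" by (simp add: out_degree_eq_card_neighbours)
  have "{w \<in> verts G. v \<rightarrow> w} \<subseteq> verts G - {v}" using adj_not_same by auto
  from card_mono[OF _ this] show "out_degree G v \<le> card (verts G) - 1"
    using assms(1) by (simp add: out_degree_eq_card_neighbours)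
qed

lemma homometric_if_equal_degree_sums:
  assumes "S \<union> T = verts G" "S \<inter> T = {}" "card S = card T"
    and "(\<Sum>v\<in>S. out_degree G v) = (\<Sum>v\<in>T. out_degree G v)"
  shows "homometric S T"
proof -
  have "card (inner_edges S) = card (inner_edges T)"
    using sum_degrees_partition[OF assms(1,2)] assms(4) by linarith
  moreover have "S \<subseteq> verts G" "T \<subseteq> verts G" using assms(1) by auto
  ultimately show ?thesis
    by (simp add: homometric_def distance_mset_eq assms(3))
qed

lemma splits_degrees_imp_homometric:
  assumes "splits (image_mset (\<lambda>v. int (out_degree G v)) (mset_set (verts G))) 0"
  shows "card (verts G) = 2 * homometric_number"
proof -
  define f where "f v = int (out_degree G v)" for v
  from assms obtain A B where AB: "image_mset f (mset_set (verts G)) = A + B" "size A = size B"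
    "\<Sum>\<^sub># A = \<Sum>\<^sub># B"
    unfolding splits_def f_def by auto
  \<comment> \<open>The split of the degree values is lifted to the vertices; since each vertex
    occurs once, both parts are sets and they are disjoint.\<close>
  from image_mset_eq_plusD[OF AB(1)] obtain A' B' where
    A'B': "mset_set (verts G) = A' + B'" "A = image_mset f A'" "B = image_mset f B'" by blast
  define S T where "S = set_mset A'" and "T = set_mset B'"
  have count: "count A' v + count B' v = of_bool (v \<in> verts G)" for v
    unfolding count_union[symmetric] A'B'(1)[symmetric] by (simp add: count_mset_set')
  then have "count A' v \<le> 1" "count B' v \<le> 1" for v
    by (metis add_leE of_bool_less_eq_one)+
  then have "A' = mset_set S" "B' = mset_set T"
    unfolding S_def T_def by (simp_all add: mset_set_set_mset_if_count_le_1)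
  have un: "S \<union> T = verts G"
    unfolding S_def T_def using arg_cong[OF A'B'(1), of set_mset] by simp
  have disj: "S \<inter> T = {}"
  proof (rule ccontr)
    assume "S \<inter> T \<noteq> {}"
    then obtain v where "v \<in># A'" "v \<in># B'" by (auto simp: S_def T_def)
    then have "2 \<le> count A' v + count B' v" by (simp flip: count_greater_zero_iff)
    with count[of v] of_bool_less_eq_one[of "v \<in> verts G", where 'a = nat] show False by linarith
  qed
  have card: "card S = card T"
    using AB(2) A'B'(2,3) \<open>A' = mset_set S\<close> \<open>B' = mset_set T\<close> by simp
  have "sum f S = sum f T"
    using AB(3) A'B'(2,3) \<open>A' = mset_set S\<close> \<open>B' = mset_set T\<close> by (simp add: sum_unfold_sum_mset)
  then have "(\<Sum>v\<in>S. out_degree G v) = (\<Sum>v\<in>T. out_degree G v)"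
    unfolding f_def by (simp flip: of_nat_sum)
  from homometric_if_equal_degree_sums[OF un disj card this]
  have "card S \<in> homometric_sizes"
    unfolding homometric_sizes_def mem_Collect_eq
    using un disj card by (intro exI[of _ S] exI[of _ T]) auto
  moreover have "card (verts G) = 2 * card S"
    using un disj card by (metis card_Un_disjoint finite_Un finite_verts mult_2)
  ultimately show ?thesis using homometric_number_eqI[of "card S"] by simp
qed

end

end

theorem theorem8:
  fixes G :: "('a, 'b) pre_digraph" and n :: nat
  assumes "graph G"
    and "n = card (verts G)" and "even n" and "n \<ge> 90"
    and "graph.diameter G = 2"
    and "real (card {i. odd (card (graph.degree_class G i))}) > real n / 2
         \<or> (\<forall>i. even (card (graph.degree_class G i)))"
  shows "real (graph.homometric_number G) = real n / 2"
proof -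
  interpret graph G by fact
  define N where "N = image_mset (\<lambda>v. int (out_degree G v)) (mset_set (verts G))"
  have size: "size N = n" by (simp add: N_def assms(2))
  have "count N (int i) = card (degree_class i)" for i
  proof -
    have "verts G \<inter> (\<lambda>v. int (out_degree G v)) -` {int i} = degree_class i"
      by (auto simp: degree_class_def)
    moreover have "sum (count (mset_set (verts G))) (degree_class i) = card (degree_class i)"
      by (simp add: degree_class_def)
    ultimately show ?thesis
      by (simp add: N_def count_image_mset Int_commute)
  qed
  moreover have "x \<in> range int" if "x \<in># N" for x
    using that by (auto simp: N_def)
  \<comment> \<open>Integers outside \<open>range int\<close> have count 0 in \<open>N\<close>,
    which is even.\<close>
  ultimately have odds: "{x. odd (count N x)} = int ` {i. odd (card (degree_class i))}"
    by (auto intro: ccontr simp: image_iff not_in_iff) (metis count_eq_zero_iff even_zero)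
  have "card {x. odd (count N x)} = card {i. odd (card (degree_class i))}"
    unfolding odds by (intro card_image) simp
  then have "size N < 2 * card {x. odd (count N x)} \<or> {x. odd (count N x)} = {}"
    using assms(6) size unfolding odds by auto
  moreover have "set_mset N \<subseteq> {1..int (size N) - 1}"
    using out_degree_bounds[OF assms(5)] assms(2,4) size by (fastforce simp: N_def)
  moreover have "even (\<Sum>\<^sub># N)"
    using even_sum_degrees by (simp add: N_def flip: sum_unfold_sum_mset of_nat_sum)
  ultimately have "splits N 0"
    using splits_if_many_odd_counts[of N] size assms(3,4) by simp
  from splits_degrees_imp_homometric[OF assms(5) this[unfolded N_def]]
  show ?thesis using assms(2) by simp
qed

end
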